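(* Let $G=(\{1,\dots,n\},E)$ be a finite simple graph and define $$\vartheta^{\lambda_{\max}}(G)=\max\big\{\lambda_{\max}(Z):\ Z\in\mathbb{R}^{n\times n},\ Z\succeq0,\ Z_{ii}=1\ \forall i\in\{1,\dots,n\},\ Z_{ij}=0\ \forall\{i,j\}\in E\big\}.$$ Then $\vartheta^{\lambda_{\max}}(G)=\vartheta(G)$, the Lovász theta number of $G$.
   Context: $Z\succeq0$ means $Z$ is symmetric positive semidefinite, and $\lambda_{\max}(Z)$ is its largest eigenvalue. The Lovász theta number $\vartheta(G)$ is defined as the optimum value of $$\min\big\{t:\ \overline z_{ii}=t-1\ \forall i,\ \ \overline z_{ij}=-1\ \forall\{i,j\}\notin E\ (i\ne j),\ \ \overline Z\succeq 0\big\},$$ over $t\in\mathbb{R}$ and real symmetric $\overline Z=(\overline z_{ij})\in\mathbb{R}^{n\times n}$. *)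

theory Defs
  imports "HOL-Analysis.Analysis"
begin

(* A simple graph on the vertex set UNIV :: 'n set, given by its set of two-element edges. *)
definition simple_graph :: "'n::finite set set \<Rightarrow> bool" where
  "simple_graph E \<longleftrightarrow> (\<forall>e\<in>E. card e = 2)"

definition psd :: "real^'n^'n \<Rightarrow> bool" where
  "psd Z \<longleftrightarrow> transpose Z = Z \<and> (\<forall>x. 0 \<le> x \<bullet> (Z *v x))"

definition eigenvalue :: "real^'n^'n \<Rightarrow> real \<Rightarrow> bool" where
  "eigenvalue Z c \<longleftrightarrow> (\<exists>v. v \<noteq> 0 \<and> Z *v v = c *\<^sub>R v)"

(* Max is meaningful for symmetric Z, whose set of real eigenvalues is finite and nonempty
   (index types are nonempty, so the size of Z is at least 1). *)
definition lambda_max :: "real^'n^'n \<Rightarrow> real" where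
  "lambda_max Z = Max {c. eigenvalue Z c}"

definition theta_feasible :: "'n::finite set set \<Rightarrow> real \<Rightarrow> real^'n^'n \<Rightarrow> bool" where
  "theta_feasible E t Z \<longleftrightarrow>
     (\<forall>i. Z $ i $ i = t - 1) \<and>
     (\<forall>i j. i \<noteq> j \<and> {i, j} \<notin> E \<longrightarrow> Z $ i $ j = - 1) \<and>
     psd Z"

(* LEAST and GREATEST are underspecified when the optimum is not attained; a statement about
   lovasz_theta and theta_lambda_max should therefore also assert attainment. *)
definition lovasz_theta :: "'n::finite set set \<Rightarrow> real" where
  "lovasz_theta E = (LEAST t. \<exists>Z. theta_feasible E t Z)"

definition theta_lambda_max_feasible :: "'n::finite set set \<Rightarrow> real^'n^'n \<Rightarrow> bool" where
  "theta_lambda_max_feasible E Z \<longleftrightarrow>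
     psd Z \<and> (\<forall>i. Z $ i $ i = 1) \<and> (\<forall>i j. {i, j} \<in> E \<longrightarrow> Z $ i $ j = 0)"

definition theta_lambda_max :: "'n::finite set set \<Rightarrow> real" where
  "theta_lambda_max E =
     (GREATEST x. \<exists>Z. theta_lambda_max_feasible E Z \<and> x = lambda_max Z)"

end

theory Submission
  imports Defs
begin

text \<open>
  Let \<open>m\<close> be the maximum of \<open>v \<bullet> (Z *v v)\<close> over the compact set of pairs of a matrix \<open>Z\<close>
  feasible for the eigenvalue problem and a unit vector \<open>v\<close>; it is the largest of the numbers
  \<open>lambda_max Z\<close>. If \<open>B\<close> is feasible for the theta problem with value \<open>t\<close>, then pairing \<open>B\<close> with the
  positive semidefinite matrix \<open>(v $ i * Z $ i $ j * v $ j)\<close> gives \<open>m \<le> t\<close>.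
  Conversely, a theta-feasible matrix of value \<open>m\<close> is a positive semidefinite completion of
  entries prescribed on the diagonal and the non-edges. The completable patterns form a closed
  convex cone, so if there were no completion, a separating hyperplane would give a positive
  semidefinite \<open>W\<close>, zero on the edges, whose entries sum to more than \<open>m\<close> times its trace.
  Scaling \<open>W\<close> to unit diagonal contradicts the choice of \<open>m\<close>.
\<close>

section \<open>Positive semidefinite matrices\<close>

lemma inner_matrix_vector_sum:
  fixes A :: "real^'n^'m"
  shows "x \<bullet> (A *v y) = (\<Sum>i\<in>UNIV. \<Sum>j\<in>UNIV. x $ i * A $ i $ j * y $ j)"
  by (simp add: inner_vec_def matrix_vector_mult_def sum_distrib_left mult.assoc)

lemma inner_matrix_sum:
  fixes A B :: "real^'n^'m"
  shows "A \<bullet> B = (\<Sum>i\<in>UNIV. \<Sum>j\<in>UNIV. A $ i $ j * B $ i $ j)"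
  by (simp add: inner_vec_def)

lemma symmetric_inner_commute:
  fixes A :: "real^'n^'n"
  assumes "transpose A = A"
  shows "x \<bullet> (A *v y) = y \<bullet> (A *v x)"
  by (metis assms dot_lmul_matrix inner_commute vector_transpose_matrix)

lemma psdD:
  assumes "psd A"
  shows "0 \<le> x \<bullet> (A *v x)" "transpose A = A" "A $ i $ j = A $ j $ i"
  using assms unfolding psd_def by (auto, metis transpose_def vec_lambda_beta)

lemma inner_axis_matrix_axis:
  fixes A :: "real^'n^'m"
  shows "axis i 1 \<bullet> (A *v axis j 1) = A $ i $ j"
  by (simp add: matrix_vector_mult_basis inner_axis' column_def)

lemma psd_diag_nonneg: "psd A \<Longrightarrow> 0 \<le> A $ i $ i"
  by (metis inner_axis_matrix_axis psdD(1))

lemma psd_quadratic_line: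
  fixes A :: "real^'n^'n"
  assumes "psd A"
  shows "(x + s *\<^sub>R y) \<bullet> (A *v (x + s *\<^sub>R y))
    = x \<bullet> (A *v x) + 2 * s * (x \<bullet> (A *v y)) + s^2 * (y \<bullet> (A *v y))"
  using symmetric_inner_commute[OF psdD(2)[OF assms], of y x]
  by (simp add: matrix_vector_right_distrib matrix_vector_mult_scaleR inner_add_left
      inner_add_right algebra_simps power2_eq_square)

text \<open>The form along the line \<open>x + s *\<^sub>R y\<close> is a nonnegative quadratic in
  \<open>s\<close>, so its discriminant is at most 0. The form may be degenerate, hence the separate
  case \<open>p = 0\<close>.\<close>

lemma psd_cauchy_schwarz:
  fixes A :: "real^'n^'n"
  assumes "psd A"
  shows "(x \<bullet> (A *v y))^2 \<le> (x \<bullet> (A *v x)) * (y \<bullet> (A *v y))"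
proof -
  define p q r where "p = y \<bullet> (A *v y)" and "q = x \<bullet> (A *v y)" and "r = x \<bullet> (A *v x)"
  have nonneg: "0 \<le> r + 2 * s * q + s^2 * p" for s
    using psdD(1)[OF assms, of "x + s *\<^sub>R y"] psd_quadratic_line[OF assms]
    by (simp add: p_def q_def r_def)
  have "0 \<le> p" using psdD(1)[OF assms] by (simp add: p_def)
  have "q^2 \<le> r * p"
  proof (cases "p = 0")
    case True
    have "q = 0"
    proof (rule ccontr)
      assume "q \<noteq> 0"
      \<comment> \<open>With \<open>p = 0\<close> the quadratic is affine in \<open>s\<close>; the
        chosen \<open>s\<close> gives it the value -1.\<close>
      then show False
        using nonneg[of "- (r + 1) / (2 * q)"] True by (simp add: field_simps)
    qed
    then show ?thesis using True by simp
  next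
    case False
    with \<open>0 \<le> p\<close> have "0 < p" by simp
    \<comment> \<open>This is the minimum of the quadratic, taken at
      \<open>s = - q / p\<close>.\<close>
    have "0 \<le> r - q^2 / p"
      using nonneg[of "- q / p"] \<open>0 < p\<close> by (simp add: power2_eq_square field_simps)
    then show ?thesis using \<open>0 < p\<close> by (simp add: field_simps)
  qed
  then show ?thesis by (simp add: p_def q_def r_def)
qed

text \<open>Cauchy-Schwarz for the vectors \<open>A *v x\<close> and \<open>x\<close> bounds the
  fourth power of the norm of \<open>A *v x\<close> by 0.\<close>

lemma psd_kernel:
  fixes A :: "real^'n^'n"
  assumes "psd A" "x \<bullet> (A *v x) = 0"
  shows "A *v x = 0"
  using psd_cauchy_schwarz[OF assms(1), of "A *v x" x] assms(2) by simp

lemma psd_entry_bound: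
  fixes A :: "real^'n^'n"
  assumes "psd A"
  shows "(A $ i $ j)^2 \<le> A $ i $ i * A $ j $ j"
  using psd_cauchy_schwarz[OF assms, of "axis i 1" "axis j 1"]
  by (simp add: inner_axis_matrix_axis)

section \<open>Closedness and compactness\<close>

lemma closed_psd: "closed {Z :: real^'n^'n. psd Z}"
proof -
  have "{Z :: real^'n^'n. psd Z} = (\<Inter>i. \<Inter>j. {Z. Z $ i $ j = Z $ j $ i}) \<inter>
      (\<Inter>x. {Z. 0 \<le> (\<Sum>i\<in>UNIV. \<Sum>j\<in>UNIV. x $ i * Z $ i $ j * x $ j)})"
    by (auto simp: psd_def inner_matrix_vector_sum[symmetric] transpose_def vec_eq_iff)
  moreover have "closed \<dots>"
    by (intro closed_Int closed_INT ballI closed_Collect_eq closed_Collect_le continuous_intros)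
  ultimately show ?thesis by simp
qed

text \<open>The 2 by 2 minors bound every entry by the diagonal entries, so a bound on the diagonal
  bounds the whole matrix.\<close>

lemma compact_psd_diag_le: "compact {Z :: real^'n^'n. psd Z \<and> (\<forall>i. Z $ i $ i \<le> c)}"
proof -
  have "closed ({Z :: real^'n^'n. psd Z} \<inter> (\<Inter>i. {Z. Z $ i $ i \<le> c}))"
    by (intro closed_Int closed_psd closed_INT ballI closed_Collect_le continuous_intros)
  moreover have "{Z :: real^'n^'n. psd Z} \<inter> (\<Inter>i. {Z. Z $ i $ i \<le> c})
      = {Z. psd Z \<and> (\<forall>i. Z $ i $ i \<le> c)}" by auto
  moreover have "bounded {Z :: real^'n^'n. psd Z \<and> (\<forall>i. Z $ i $ i \<le> c)}"
  proof (rule boundedI)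
    fix Z :: "real^'n^'n" assume "Z \<in> {Z. psd Z \<and> (\<forall>i. Z $ i $ i \<le> c)}"
    then have Z: "psd Z" "\<And>i. Z $ i $ i \<le> c" by auto
    have "0 \<le> c" using psd_diag_nonneg[OF Z(1)] Z(2) order_trans by blast
    have entry: "\<bar>Z $ i $ j\<bar> \<le> c" for i j
    proof (rule abs_le_square_iff[THEN iffD2, of _ c, simplified \<open>0 \<le> c\<close> abs_of_nonneg])
      have "Z $ i $ i * Z $ j $ j \<le> c * c"
        using psd_diag_nonneg[OF Z(1)] Z(2) \<open>0 \<le> c\<close> by (intro mult_mono) auto
      then show "(Z $ i $ j)^2 \<le> c^2"
        using psd_entry_bound[OF Z(1), of i j] by (simp add: power2_eq_square)
    qed
    have "norm Z \<le> (\<Sum>i\<in>UNIV. norm (Z $ i))"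
      by (simp add: norm_vec_def L2_set_le_sum)
    also have "\<dots> \<le> (\<Sum>i\<in>(UNIV::'n set). \<Sum>j\<in>(UNIV::'n set). c)"
      by (intro sum_mono order_trans[OF norm_le_l1_cart] entry)
    finally show "norm Z \<le> (\<Sum>i\<in>(UNIV::'n set). \<Sum>j\<in>(UNIV::'n set). c)" .
  qed
  ultimately show ?thesis by (simp add: compact_eq_bounded_closed)
qed

section \<open>Rank-one matrices and self-duality of the psd cone\<close>

definition outer :: "real^'n \<Rightarrow> real^'n^'n" where
  "outer u = (\<chi> i j. u $ i * u $ j)"

lemma inner_outer: "A \<bullet> outer x = x \<bullet> (A *v x)"
  by (simp add: inner_matrix_sum inner_matrix_vector_sum outer_def ac_simps)

lemma quadratic_outer: "x \<bullet> (outer u *v x) = (x \<bullet> u)^2"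
  unfolding inner_matrix_vector_sum outer_def power2_eq_square
  by (simp add: inner_vec_def sum_product ac_simps)

lemma psd_outer: "psd (outer u)"
  by (auto simp: psd_def quadratic_outer) (simp add: outer_def transpose_def mult.commute)

lemma psd_add: "psd A \<Longrightarrow> psd B \<Longrightarrow> psd (A + B)"
  unfolding psd_def transpose_def
  by (auto simp: matrix_vector_mult_add_rdistrib inner_add_right vec_eq_iff)

lemma psd_scaleR: "psd A \<Longrightarrow> 0 \<le> c \<Longrightarrow> psd (c *\<^sub>R A)"
  unfolding psd_def transpose_def
  by (auto simp: scaleR_matrix_vector_assoc[symmetric] vec_eq_iff)

text \<open>One step of the Cholesky decomposition clears the \<open>k\<close>-th row and column.\<close>

lemma psd_eliminate:
  fixes A :: "real^'n^'n"
  assumes A: "psd A" and k: "A $ k $ k \<noteq> 0"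
  shows "psd (A - (1 / A $ k $ k) *\<^sub>R outer (A *v axis k 1))"
proof -
  have pos: "0 < A $ k $ k" using psd_diag_nonneg[OF A] k by (simp add: order_less_le)
  have "0 \<le> x \<bullet> (A *v x) - (x \<bullet> (A *v axis k 1))^2 / A $ k $ k" for x
    using psd_cauchy_schwarz[OF A, of x "axis k 1"] pos
    by (simp add: inner_axis_matrix_axis field_simps)
  then show ?thesis
    using psdD(3)[OF A]
    by (auto simp: psd_def matrix_vector_mult_diff_rdistrib inner_diff_right
        scaleR_matrix_vector_assoc[symmetric] quadratic_outer)
       (auto simp: transpose_def vec_eq_iff outer_def mult.commute)
qed

text \<open>Elimination splits \<open>A\<close> into nonnegative multiples of rank-one matrices, and
  pairing \<open>B\<close> with \<open>outer u\<close> gives the form of \<open>B\<close> at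
  \<open>u\<close>. The induction runs over a set \<open>S\<close> outside which the diagonal of
  \<open>A\<close> vanishes.\<close>

theorem psd_inner_nonneg:
  fixes A B :: "real^'n^'n"
  assumes A: "psd A" and B: "psd B"
  shows "0 \<le> A \<bullet> B"
proof -
  have "\<lbrakk>psd A; \<And>i. i \<notin> S \<Longrightarrow> A $ i $ i = 0\<rbrakk> \<Longrightarrow> 0 \<le> A \<bullet> B" if "finite S" for S and A :: "real^'n^'n"
    using that
  proof (induction S arbitrary: A rule: finite_induct)
    case empty
    have "A $ i $ j = 0" for i j
      using psd_entry_bound[OF empty(1), of i j] empty(2) by simp
    then show ?case by (simp add: inner_matrix_sum)
  next
    case (insert k S)
    show ?case
    proof (cases "A $ k $ k = 0")
      case True
      then have "A $ i $ i = 0" if "i \<notin> S" for i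
        using insert.prems(2)[of i] that by (cases "i = k") auto
      then show ?thesis using insert.IH insert.prems(1) by blast
    next
      case False
      define u where "u = A *v axis k 1"
      define A' where "A' = A - (1 / A $ k $ k) *\<^sub>R outer u"
      have pos: "0 < A $ k $ k"
        using psd_diag_nonneg[OF insert.prems(1)] False by (simp add: order_less_le)
      have psd: "psd A'" using psd_eliminate[OF insert.prems(1) False] by (simp add: A'_def u_def)
      have "A' $ i $ i = 0" if "i \<notin> S" for i
      proof (cases "i = k")
        case True
        then show ?thesis
          using pos by (simp add: A'_def u_def outer_def matrix_vector_mult_basis column_def)
      next
        case False
        then have "A $ i $ i = 0" using that insert.prems(2) by simp
        \<comment> \<open>Elimination only lowers diagonal entries, and a psd matrix has none below
          0; so zeros stay zeros.\<close>
        then have "A' $ i $ i \<le> 0" using pos by (simp add: A'_def outer_def)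
        then show ?thesis using psd_diag_nonneg[OF psd, of i] by simp
      qed
      then have "0 \<le> A' \<bullet> B" using insert.IH psd by blast
      moreover have "0 \<le> outer u \<bullet> B"
        using psdD(1)[OF B] by (simp add: inner_commute[of _ B] inner_outer)
      moreover have "A \<bullet> B = A' \<bullet> B + (1 / A $ k $ k) * (outer u \<bullet> B)"
        by (simp add: A'_def inner_diff_left)
      ultimately show ?thesis using pos by simp
    qed
  qed
  from this[of UNIV A] A show ?thesis by simp
qed

section \<open>The largest eigenvalue\<close>

text \<open>Eigenvectors for distinct eigenvalues are orthogonal, hence independent. Finiteness is
  what makes the \<open>Max\<close> in \<open>lambda_max\<close> meaningful.\<close>

lemma finite_eigenvalues_symmetric:
  fixes Z :: "real^'n^'n"
  assumes "transpose Z = Z"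
  shows "finite {c. eigenvalue Z c}"
proof -
  let ?C = "{c. eigenvalue Z c}"
  have "\<exists>f. \<forall>c\<in>?C. f c \<noteq> 0 \<and> Z *v f c = c *\<^sub>R f c"
    by (rule bchoice) (auto simp: eigenvalue_def)
  then obtain f where f: "\<And>c. c \<in> ?C \<Longrightarrow> f c \<noteq> 0" "\<And>c. c \<in> ?C \<Longrightarrow> Z *v f c = c *\<^sub>R f c"
    by blast
  have orth: "f c \<bullet> f d = 0" if "c \<in> ?C" "d \<in> ?C" "c \<noteq> d" for c d
    using symmetric_inner_commute[OF assms, of "f c" "f d"] f(2)[OF that(1)] f(2)[OF that(2)] that(3)
    by (simp add: inner_commute)
  have inj: "inj_on f ?C"
    by (rule inj_onI) (metis f(1) inner_eq_zero_iff orth)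
  have "pairwise orthogonal (f ` ?C)"
    by (auto simp: pairwise_def orthogonal_def intro!: orth)
  moreover have "0 \<notin> f ` ?C" using f(1) by (metis imageE)
  ultimately have "independent (f ` ?C)" by (rule pairwise_orthogonal_independent)
  then have "finite (f ` ?C)" by (rule independent_imp_finite)
  then show ?thesis using inj by (rule finite_imageD)
qed

lemma eigenvalue_le_quadratic_bound:
  fixes Z :: "real^'n^'n"
  assumes "eigenvalue Z c" and bound: "\<And>x. x \<bullet> (Z *v x) \<le> m * (x \<bullet> x)"
  shows "c \<le> m"
proof -
  obtain v where v: "v \<noteq> 0" "Z *v v = c *\<^sub>R v" using assms(1) by (auto simp: eigenvalue_def)
  have "c * (v \<bullet> v) \<le> m * (v \<bullet> v)" using bound[of v] v(2) by simp
  moreover have "0 < v \<bullet> v" using v(1) by simp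
  ultimately show ?thesis using mult_le_cancel_right_pos by blast
qed

text \<open>The matrix \<open>mat m - Z\<close> is psd and its form vanishes at \<open>v\<close>, so
  \<open>v\<close> lies in its kernel: a maximizer of the Rayleigh quotient is an
  eigenvector.\<close>

lemma lambda_max_eqI:
  fixes Z :: "real^'n^'n"
  assumes sym: "transpose Z = Z" and bound: "\<And>x. x \<bullet> (Z *v x) \<le> m * (x \<bullet> x)"
    and v: "v \<noteq> 0" "v \<bullet> (Z *v v) = m * (v \<bullet> v)"
  shows "lambda_max Z = m"
proof -
  have mv: "(mat m :: real^'n^'n) *v x = m *\<^sub>R x" for x
    by (simp add: vec_eq_iff matrix_vector_mult_def mat_def if_distrib[of "\<lambda>a. a * _"] cong: if_cong)
  have "psd (mat m - Z)"
    using sym bound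
    by (auto simp: psd_def matrix_vector_mult_diff_rdistrib mv inner_diff_right)
       (auto simp: transpose_def vec_eq_iff mat_def)
  moreover have "v \<bullet> ((mat m - Z) *v v) = 0"
    using v(2) by (simp add: matrix_vector_mult_diff_rdistrib mv inner_diff_right)
  ultimately have "(mat m - Z) *v v = 0" by (rule psd_kernel)
  then have "Z *v v = m *\<^sub>R v" by (simp add: matrix_vector_mult_diff_rdistrib mv)
  then have "eigenvalue Z m" using v(1) by (auto simp: eigenvalue_def)
  then show ?thesis
    unfolding lambda_max_def
    by (intro Max_eqI finite_eigenvalues_symmetric[OF sym])
       (auto intro: eigenvalue_le_quadratic_bound bound)
qed

lemma quadratic_bound_sphere:
  fixes Z :: "real^'n^'n"
  assumes "\<And>x. norm x = 1 \<Longrightarrow> x \<bullet> (Z *v x) \<le> m"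
  shows "x \<bullet> (Z *v x) \<le> m * (x \<bullet> x)"
proof (cases "x = 0")
  case False
  define y where "y = (1 / norm x) *\<^sub>R x"
  have "norm y = 1" using False by (simp add: y_def)
  have x: "x = norm x *\<^sub>R y" using False by (simp add: y_def)
  have "x \<bullet> (Z *v x) = (norm x)^2 * (y \<bullet> (Z *v y))"
    by (subst (1 2) x) (simp add: matrix_vector_mult_scaleR power2_eq_square)
  also have "\<dots> \<le> (norm x)^2 * m"
    using assms[OF \<open>norm y = 1\<close>] by (intro mult_left_mono) auto
  finally show ?thesis by (simp add: power2_norm_eq_inner mult.commute)
qed simp

lemma continuous_on_quadratic_form:
  "continuous_on S (\<lambda>p :: (real^'n^'n) \<times> (real^'n). snd p \<bullet> (fst p *v snd p))"
  unfolding inner_matrix_vector_sum by (intro continuous_intros)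

lemma lambda_max_attained:
  fixes Z :: "real^'n^'n"
  assumes sym: "transpose Z = Z"
  obtains v where "norm v = 1" "v \<bullet> (Z *v v) = lambda_max Z"
proof -
  have "axis undefined 1 \<in> sphere (0 :: real^'n) 1" by simp
  then have nonempty: "{Z} \<times> sphere (0 :: real^'n) 1 \<noteq> {}" by blast
  \<comment> \<open>The singleton factor allows the joint continuity in matrix and vector to be used
    for a fixed \<open>Z\<close>.\<close>
  have "\<exists>p \<in> {Z} \<times> sphere 0 1. \<forall>q \<in> {Z} \<times> sphere 0 1.
      snd q \<bullet> (fst q *v snd q) \<le> snd p \<bullet> (fst p *v snd p)"
    by (intro continuous_attains_sup nonempty compact_Times compact_sphere finite_imp_compact
        continuous_on_quadratic_form) simp
  then obtain v where v: "norm v = 1" "\<And>x. norm x = 1 \<Longrightarrow> x \<bullet> (Z *v x) \<le> v \<bullet> (Z *v v)"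
    by (auto simp: sphere_def)
  have "lambda_max Z = v \<bullet> (Z *v v)"
    using v(1) by (intro lambda_max_eqI[of _ _ v] sym quadratic_bound_sphere v(2))
      (auto simp: dot_square_norm)
  then show ?thesis using that v(1) by simp
qed

section \<open>Semidefinite duality for the theta number\<close>

lemma simple_graph_singleton:
  assumes "simple_graph E"
  shows "{i} \<notin> E"
  using assms by (auto simp: simple_graph_def)

lemma theta_lambda_max_feasible_mat:
  assumes "simple_graph E"
  shows "theta_lambda_max_feasible E (mat 1)"
  using simple_graph_singleton[OF assms]
  by (auto simp: theta_lambda_max_feasible_def psd_def transpose_mat) (auto simp: mat_def)

lemma compact_theta_lambda_max_feasible:
  fixes E :: "'n::finite set set"
  shows "compact {Z. theta_lambda_max_feasible E Z}"
proof -
  have "{Z. theta_lambda_max_feasible E Z} = {Z. psd Z \<and> (\<forall>i. Z $ i $ i \<le> 1)} \<inter>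
      ((\<Inter>i. {Z. Z $ i $ i = 1}) \<inter> (\<Inter>i. \<Inter>j. {Z. {i, j} \<in> E \<longrightarrow> Z $ i $ j = 0}))"
    by (auto simp: theta_lambda_max_feasible_def)
  moreover have "compact \<dots>"
    by (intro compact_Int_closed compact_psd_diag_le closed_Int closed_INT ballI closed_Collect_eq
        closed_Collect_imp open_Collect_const continuous_intros)
  ultimately show ?thesis by simp
qed

text \<open>The scaled matrix \<open>X\<close> vanishes on the edges, exactly where the entries of
  \<open>B\<close> are unknown; so \<open>X \<bullet> B\<close> is determined by \<open>t\<close>,
  \<open>v\<close> and \<open>Z\<close>, and it is nonnegative by self-duality.\<close>

lemma theta_weak_duality:
  fixes E :: "'n::finite set set"
  assumes Z: "theta_lambda_max_feasible E Z" and B: "theta_feasible E t B"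
  shows "v \<bullet> (Z *v v) \<le> t * (v \<bullet> v)"
proof -
  define X :: "real^'n^'n" where "X = (\<chi> i j. v $ i * Z $ i $ j * v $ j)"
  have quad: "x \<bullet> (X *v x) = (\<chi> i. x $ i * v $ i) \<bullet> (Z *v (\<chi> i. x $ i * v $ i))" for x
    by (simp add: inner_matrix_vector_sum X_def ac_simps)
  have psdZ: "psd Z" and psdB: "psd B"
    using Z B by (auto simp: theta_lambda_max_feasible_def theta_feasible_def)
  have "psd X"
    using psdD(1,3)[OF psdZ] by (simp add: psd_def quad) (simp add: X_def transpose_def vec_eq_iff)
  then have "0 \<le> X \<bullet> B" using psdB by (rule psd_inner_nonneg)
  also have "X \<bullet> B = (\<Sum>i\<in>UNIV. \<Sum>j\<in>UNIV. (if j = i then t * (v $ i * v $ i) else 0) - X $ i $ j)"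
    unfolding inner_matrix_sum
  proof (intro sum.cong refl)
    fix i j
    show "X $ i $ j * B $ i $ j = (if j = i then t * (v $ i * v $ i) else 0) - X $ i $ j"
    proof (cases "i = j")
      case True
      have "Z $ i $ i = 1" "B $ i $ i = t - 1"
        using Z B by (simp_all add: theta_lambda_max_feasible_def theta_feasible_def)
      then show ?thesis using True by (simp add: X_def left_diff_distrib mult.commute)
    next
      case False
      then show ?thesis
        using Z B by (cases "{i, j} \<in> E")
          (auto simp: X_def theta_lambda_max_feasible_def theta_feasible_def)
    qed
  qed
  also have "\<dots> = t * (v \<bullet> v) - v \<bullet> (Z *v v)"
    unfolding inner_matrix_vector_sum
    by (simp add: sum_subtractf X_def inner_vec_def[of v v] sum_distrib_left)
  finally show ?thesis by simp
qed

text \<open>Rescaling \<open>W\<close> to unit diagonal turns the sum of its entries into a value of the quadratic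
  form, taken at the vector of the numbers \<open>sqrt (W $ i $ i)\<close>. Rows of \<open>W\<close> with vanishing diagonal
  entry vanish altogether, so \<open>x / 0 = 0\<close> yields the right entries there, except on the diagonal.\<close>

lemma psd_sum_le_trace:
  fixes W :: "real^'n::finite^'n"
  assumes "simple_graph E"
    and bound: "\<And>Z x. theta_lambda_max_feasible E Z \<Longrightarrow> x \<bullet> (Z *v x) \<le> m * (x \<bullet> x)"
    and W: "psd W" and edge: "\<And>i j. {i, j} \<in> E \<Longrightarrow> W $ i $ j = 0"
  shows "(\<Sum>i\<in>UNIV. \<Sum>j\<in>UNIV. W $ i $ j) \<le> m * (\<Sum>i\<in>UNIV. W $ i $ i)"
proof -
  define s where "s i = sqrt (W $ i $ i)" for i
  have s2: "s i * s i = W $ i $ i" for i using psd_diag_nonneg[OF W] by (simp add: s_def)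
  define Z :: "real^'n^'n" where
    "Z = (\<chi> i j. W $ i $ j / (s i * s j) + (if j = i then if s i = 0 then 1 else 0 else 0))"
  have quad: "x \<bullet> (Z *v x) = (\<chi> i. x $ i / s i) \<bullet> (W *v (\<chi> i. x $ i / s i))
      + (\<Sum>i\<in>UNIV. if s i = 0 then (x $ i)^2 else 0)" for x
  proof -
    have "x $ i * Z $ i $ j * x $ j = x $ i / s i * W $ i $ j * (x $ j / s j)
        + (if j = i then if s i = 0 then (x $ i)^2 else 0 else 0)" for i j
      by (simp add: Z_def algebra_simps power2_eq_square)
    then show ?thesis by (simp add: inner_matrix_vector_sum sum.distrib)
  qed
  have "psd Z"
    using psdD(1)[OF W] psdD(3)[OF W]
    by (auto simp: psd_def quad intro!: add_nonneg_nonneg sum_nonneg)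
       (auto simp: Z_def transpose_def vec_eq_iff mult.commute)
  moreover have "Z $ i $ i = 1" for i
    using s2[of i] by (auto simp: Z_def)
  \<comment> \<open>Edges join distinct vertices, so the diagonal correction in \<open>Z\<close>
    does not affect them.\<close>
  moreover have "Z $ i $ j = 0" if "{i, j} \<in> E" for i j
    using edge[OF that] that simple_graph_singleton[OF assms(1)] by (auto simp: Z_def)
  ultimately have "theta_lambda_max_feasible E Z"
    by (simp add: theta_lambda_max_feasible_def)
  from bound[OF this, of "\<chi> i. s i"]
  have "(\<Sum>i\<in>UNIV. \<Sum>j\<in>UNIV. s i * Z $ i $ j * s j) \<le> m * (\<Sum>i\<in>UNIV. W $ i $ i)"
    unfolding inner_matrix_vector_sum by (simp add: inner_vec_def s2)
  moreover have "s i * Z $ i $ j * s j = W $ i $ j" for i j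
  proof (cases "s i = 0 \<or> s j = 0")
    case True
    then have "W $ i $ i * W $ j $ j = 0" using s2 by (metis mult_eq_0_iff)
    with psd_entry_bound[OF W, of i j] have "(W $ i $ j)^2 \<le> 0" by linarith
    then have "W $ i $ j = 0" by simp
    then show ?thesis using True by (auto simp: Z_def)
  next
    case False
    then show ?thesis by (simp add: Z_def)
  qed
  ultimately show ?thesis by simp
qed

section \<open>The cone of completable patterns\<close>

text \<open>A partial matrix is represented by a full one whose entries outside \<open>S\<close> are
  arbitrary, so that the patterns form a cone in the space of all matrices.\<close>

definition psd_completable :: "('n \<times> 'n) set \<Rightarrow> (real^'n^'n) set" where
  "psd_completable S = {M. \<exists>Z. psd Z \<and> (\<forall>(i, j)\<in>S. M $ i $ j = Z $ i $ j)}"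

text \<open>A completion is bounded by its diagonal, which is prescribed; hence completions of a
  convergent sequence subconverge.\<close>

lemma closed_psd_completable:
  fixes S :: "('n::finite \<times> 'n) set"
  assumes diag: "\<And>i. (i, i) \<in> S"
  shows "closed (psd_completable S)"
  unfolding closed_sequential_limits
proof (intro allI impI, elim conjE)
  fix M :: "nat \<Rightarrow> real^'n^'n" and L
  assume "\<forall>n. M n \<in> psd_completable S" and L: "M \<longlonglongrightarrow> L"
  then have "\<forall>n. \<exists>Z. psd Z \<and> (\<forall>(i, j)\<in>S. M n $ i $ j = Z $ i $ j)"
    by (simp add: psd_completable_def)
  then obtain Z where "\<forall>n. psd (Z n) \<and> (\<forall>(i, j)\<in>S. M n $ i $ j = Z n $ i $ j)"
    using choice[of "\<lambda>n Z. psd Z \<and> (\<forall>(i, j)\<in>S. M n $ i $ j = Z $ i $ j)"] by blast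
  then have Z: "\<And>n. psd (Z n)" "\<And>n i j. (i, j) \<in> S \<Longrightarrow> M n $ i $ j = Z n $ i $ j"
    by auto
  obtain c where c: "\<And>n. norm (M n) \<le> c"
    using convergent_imp_bounded[OF L] by (auto simp: bounded_iff)
  have "Z n $ i $ i \<le> c" for n i
    using Z(2)[OF diag, of n i] component_le_norm_cart[of "M n $ i" i]
      Finite_Cartesian_Product.norm_nth_le[of "M n" i] c[of n]
    by simp
  then have "\<forall>n. Z n \<in> {Z. psd Z \<and> (\<forall>i. Z $ i $ i \<le> c)}" using Z(1) by simp
  then obtain Y r where Y: "psd Y" and r: "strict_mono r" and lim: "(Z \<circ> r) \<longlonglongrightarrow> Y"
    using compact_psd_diag_le[of c] unfolding compact_def by blast
  have "L $ i $ j = Y $ i $ j" if "(i, j) \<in> S" for i j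
  proof (rule LIMSEQ_unique)
    have "(M \<circ> r) \<longlonglongrightarrow> L" using L r by (rule LIMSEQ_subseq_LIMSEQ)
    then show "(\<lambda>n. M (r n) $ i $ j) \<longlonglongrightarrow> L $ i $ j" by (auto intro!: tendsto_vec_nth simp: o_def)
    show "(\<lambda>n. M (r n) $ i $ j) \<longlonglongrightarrow> Y $ i $ j"
      using lim Z(2)[OF that] by (auto intro!: tendsto_vec_nth simp: o_def)
  qed
  then show "L \<in> psd_completable S" using Y by (auto simp: psd_completable_def)
qed

lemma psd_completable_add_scaleR:
  assumes "M \<in> psd_completable S" "N \<in> psd_completable S" "0 \<le> a" "0 \<le> b"
  shows "a *\<^sub>R M + b *\<^sub>R N \<in> psd_completable S"
proof -
  obtain X Y where "psd X" "\<forall>(i, j)\<in>S. M $ i $ j = X $ i $ j" "psd Y" "\<forall>(i, j)\<in>S. N $ i $ j = Y $ i $ j"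
    using assms(1,2) by (auto simp: psd_completable_def)
  then show ?thesis
    using assms(3,4) unfolding psd_completable_def
    by (fastforce intro!: exI[of _ "a *\<^sub>R X + b *\<^sub>R Y"] psd_add psd_scaleR)
qed

text \<open>A Farkas-type certificate: the symmetric members of the dual of the cone of completable
  patterns are the psd matrices supported on \<open>S\<close>.\<close>

lemma psd_completable_separation:
  fixes S :: "('n::finite \<times> 'n) set" and M :: "real^'n^'n"
  assumes diag: "\<And>i. (i, i) \<in> S" and symS: "\<And>i j. (i, j) \<in> S \<Longrightarrow> (j, i) \<in> S"
    and symM: "transpose M = M" and M: "M \<notin> psd_completable S"
  obtains W where "psd W" "\<And>i j. (i, j) \<notin> S \<Longrightarrow> W $ i $ j = 0" "W \<bullet> M < 0"
proof -
  let ?K = "psd_completable S"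
  have "convex ?K" by (auto simp: convex_def intro!: psd_completable_add_scaleR)
  then obtain a b where ab: "a \<bullet> M < b" "\<And>x. x \<in> ?K \<Longrightarrow> b < a \<bullet> x"
    using separating_hyperplane_closed_point closed_psd_completable[OF diag] M by metis
  have psd_mem: "Z \<in> ?K" if "psd Z" for Z using that by (auto simp: psd_completable_def)
  have "psd (0 :: real^'n^'n)" by (simp add: psd_def transpose_def vec_eq_iff)
  then have zero: "0 \<in> ?K" by (rule psd_mem)
  then have "b < 0" using ab(2)[of 0] by simp
  have nonneg: "0 \<le> a \<bullet> x" if "x \<in> ?K" for x
  proof (rule ccontr)
    assume "\<not> 0 \<le> a \<bullet> x"
    then have neg: "a \<bullet> x < 0" by simp
    \<comment> \<open>The factor is positive and makes the functional equal to \<open>b\<close>,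
      against the strict separation.\<close>
    have "(b / (a \<bullet> x)) *\<^sub>R x + 0 *\<^sub>R x \<in> ?K"
      using that neg \<open>b < 0\<close> by (intro psd_completable_add_scaleR) (auto simp: divide_nonpos_neg)
    then show False using ab(2)[of "(b / (a \<bullet> x)) *\<^sub>R x"] neg by simp
  qed
  have supp: "a $ i $ j = 0" if "(i, j) \<notin> S" for i j
  proof -
    \<comment> \<open>Both signs of a matrix unit off \<open>S\<close> are completed by the zero
      matrix, so the functional vanishes on it.\<close>
    have mem: "c *\<^sub>R axis i (axis j 1) \<in> ?K" for c
      unfolding psd_completable_def using that \<open>psd 0\<close>
      by (auto intro!: exI[of _ 0] simp: axis_def)
    show ?thesis
      using nonneg[OF mem[of 1]] nonneg[OF mem[of "-1"]] by (simp add: inner_axis)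
  qed
  \<comment> \<open>The separating \<open>a\<close> need not be symmetric; symmetrizing changes
    neither its quadratic form nor its pairing with the symmetric \<open>M\<close>.\<close>
  define W where "W = (1/2) *\<^sub>R (a + transpose a)"
  have "transpose W = W" by (simp add: W_def transpose_def vec_eq_iff)
  moreover have "x \<bullet> (W *v x) = x \<bullet> (a *v x)" for x
  proof -
    have "x \<bullet> (transpose a *v x) = x \<bullet> (a *v x)"
      by (metis dot_lmul_matrix inner_commute vector_transpose_matrix transpose_transpose)
    then show ?thesis
      by (simp add: W_def scaleR_matrix_vector_assoc[symmetric] matrix_vector_mult_add_rdistrib
          inner_add_right)
  qed
  ultimately have "psd W"
    using nonneg[OF psd_mem[OF psd_outer]] by (simp add: psd_def inner_outer)
  moreover have "W $ i $ j = 0" if "(i, j) \<notin> S" for i j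
    using supp[of i j] supp[of j i] symS that by (auto simp: W_def transpose_def)
  moreover have "W \<bullet> M = a \<bullet> M"
  proof -
    have "transpose a \<bullet> M = a \<bullet> transpose M"
      unfolding inner_matrix_sum transpose_def by (subst sum.swap) simp
    then show ?thesis using symM by (simp add: W_def inner_add_left)
  qed
  then have "W \<bullet> M < 0" using ab(1) \<open>b < 0\<close> by simp
  ultimately show ?thesis using that by blast
qed

lemma theta_strong_duality:
  fixes E :: "'n::finite set set"
  assumes E: "simple_graph E"
    and bound: "\<And>Z x. theta_lambda_max_feasible E Z \<Longrightarrow> x \<bullet> (Z *v x) \<le> m * (x \<bullet> x)"
  obtains Z where "theta_feasible E m Z"
proof -
  define S where "S = {(i, j). {i, j} \<notin> E}"
  \<comment> \<open>This is \<open>m\<close> times the identity minus the all-ones matrix; only its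
    entries on \<open>S\<close> are prescribed.\<close>
  define M :: "real^'n^'n" where "M = (\<chi> i j. (if j = i then m else 0) - 1)"
  have diag: "(i, i) \<in> S" for i using simple_graph_singleton[OF E] by (simp add: S_def)
  have "M \<in> psd_completable S"
  proof (rule ccontr)
    assume M: "M \<notin> psd_completable S"
    have symS: "(j, i) \<in> S" if "(i, j) \<in> S" for i j
      using that by (simp add: S_def insert_commute)
    have symM: "transpose M = M" by (auto simp: M_def transpose_def vec_eq_iff)
    obtain W where W: "psd W" "\<And>i j. (i, j) \<notin> S \<Longrightarrow> W $ i $ j = 0" "W \<bullet> M < 0"
      using psd_completable_separation[OF diag symS symM M] by blast
    have "W $ i $ j * M $ i $ j = (if j = i then m * W $ i $ i else 0) - W $ i $ j" for i j
      by (simp add: M_def algebra_simps)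
    then have "W \<bullet> M = m * (\<Sum>i\<in>UNIV. W $ i $ i) - (\<Sum>i\<in>UNIV. \<Sum>j\<in>UNIV. W $ i $ j)"
      by (simp add: inner_matrix_sum sum_subtractf sum_distrib_left)
    moreover have "(\<Sum>i\<in>UNIV. \<Sum>j\<in>UNIV. W $ i $ j) \<le> m * (\<Sum>i\<in>UNIV. W $ i $ i)"
      using W(2) by (intro psd_sum_le_trace[OF E bound W(1)]) (auto simp: S_def)
    ultimately show False using W(3) by simp
  qed
  then obtain Z where Z: "psd Z" "\<And>i j. (i, j) \<in> S \<Longrightarrow> M $ i $ j = Z $ i $ j"
    by (auto simp: psd_completable_def)
  have "Z $ i $ i = m - 1" for i
    using Z(2)[OF diag, of i] by (simp add: M_def)
  moreover have "Z $ i $ j = - 1" if "i \<noteq> j" "{i, j} \<notin> E" for i j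
    using Z(2)[of i j] that by (simp add: M_def S_def)
  ultimately have "theta_feasible E m Z"
    using Z(1) by (simp add: theta_feasible_def)
  then show ?thesis by (rule that)
qed

theorem theorem1:
  fixes E :: "'n::finite set set"
  assumes "simple_graph E"
  shows "(\<exists>Z. theta_lambda_max_feasible E Z \<and> lambda_max Z = theta_lambda_max E)
    \<and> (\<forall>Z. theta_lambda_max_feasible E Z \<longrightarrow> lambda_max Z \<le> theta_lambda_max E)
    \<and> (\<exists>Z. theta_feasible E (lovasz_theta E) Z)
    \<and> (\<forall>t Z. theta_feasible E t Z \<longrightarrow> lovasz_theta E \<le> t)
    \<and> theta_lambda_max E = lovasz_theta E"
proof -
  \<comment> \<open>Maximizing over matrix and unit vector together gives attainment without any
    continuity of \<open>lambda_max\<close>.\<close>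
  let ?D = "{Z. theta_lambda_max_feasible E Z} \<times> sphere (0 :: real^'n) 1"
  have "(mat 1, axis undefined 1) \<in> ?D"
    using theta_lambda_max_feasible_mat[OF assms] by simp
  then have "?D \<noteq> {}" by blast
  then have "\<exists>p\<in>?D. \<forall>q\<in>?D. snd q \<bullet> (fst q *v snd q) \<le> snd p \<bullet> (fst p *v snd p)"
    by (intro continuous_attains_sup compact_Times compact_theta_lambda_max_feasible compact_sphere
        continuous_on_quadratic_form)
  then obtain Z0 v0 where Z0: "theta_lambda_max_feasible E Z0" and v0: "norm v0 = 1"
    and max: "\<And>Z v. theta_lambda_max_feasible E Z \<Longrightarrow> norm v = 1 \<Longrightarrow> v \<bullet> (Z *v v) \<le> v0 \<bullet> (Z0 *v v0)"
    by (auto simp: sphere_def)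
  define m where "m = v0 \<bullet> (Z0 *v v0)"
  have sym: "transpose Z = Z" if "theta_lambda_max_feasible E Z" for Z
    using that by (simp add: theta_lambda_max_feasible_def psd_def)
  have bound: "x \<bullet> (Z *v x) \<le> m * (x \<bullet> x)" if "theta_lambda_max_feasible E Z" for Z x
    using max[OF that] unfolding m_def by (rule quadratic_bound_sphere)
  have le: "lambda_max Z \<le> m" if "theta_lambda_max_feasible E Z" for Z
    using lambda_max_attained[OF sym[OF that]] max[OF that] unfolding m_def by metis
  have eq: "lambda_max Z0 = m"
    using v0 by (intro lambda_max_eqI[of _ _ v0] sym Z0 bound) (auto simp: m_def dot_square_norm)
  have primal: "theta_lambda_max E = m"
    unfolding theta_lambda_max_def using Z0 eq le by (intro Greatest_equality) auto
  have weak: "m \<le> t" if "theta_feasible E t Z" for t Z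
    using theta_weak_duality[OF Z0 that, of v0] v0 by (simp add: m_def dot_square_norm)
  obtain B where B: "theta_feasible E m B"
    using theta_strong_duality[OF assms bound] by blast
  have dual: "lovasz_theta E = m"
    unfolding lovasz_theta_def using B weak by (intro Least_equality) auto
  show ?thesis using Z0 eq le B weak primal dual by auto
qed

end
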